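(* Let $p$ and $q$ be distinct primes with $p>q$. Then, as polynomials in the indeterminate $X$ with integer coefficients, $$\Phi_{pq}(X) = 1+(X-1)\sum_{i=0}^{q-1}\sum_{j=1}^{\lfloor pi/q\rfloor}X^{pi - qj}.$$
   Context: $\Phi_n(X)$ denotes the $n$-th cyclotomic polynomial. $\lfloor x\rfloor$ denotes the floor of $x$; an inner sum whose upper limit is $0$ is empty (equal to $0$). *)

theory Defs
  imports Complex_Main "HOL-Computational_Algebra.Computational_Algebra"
begin

definition primitive_root_of_unity :: "nat \<Rightarrow> complex \<Rightarrow> bool" where
  "primitive_root_of_unity n z \<longleftrightarrow> n > 0 \<and> z ^ n = 1 \<and> (\<forall>k. 0 < k \<and> k < n \<longrightarrow> z ^ k \<noteq> 1)"

definition complex_cyclotomic :: "nat \<Rightarrow> complex poly" where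
  "complex_cyclotomic n = (\<Prod>z | primitive_root_of_unity n z. [:-z, 1:])"

text \<open>
  The cyclotomic polynomial as a polynomial over the integers. That such an integer
  polynomial exists and is unique (so that the description is proper) is shown below
  in \<open>of_int_cyclotomic\<close> and \<open>cyclotomic_eqI\<close>.
\<close>
definition cyclotomic :: "nat \<Rightarrow> int poly" where
  "cyclotomic n = (THE P. map_poly of_int P = complex_cyclotomic n)"

lemma primitive_root_of_unity_unique:
  assumes "primitive_root_of_unity m z" "primitive_root_of_unity n z"
  shows "m = n"
  using assms unfolding primitive_root_of_unity_def by (metis linorder_neqE_nat)

lemma finite_primitive_roots: "finite {z. primitive_root_of_unity n z}"
proof (cases "n = 0")
  case False
  then show ?thesis
    by (intro finite_subset[OF _ finite_roots_unity[of n]])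
       (auto simp: primitive_root_of_unity_def)
qed (auto simp: primitive_root_of_unity_def)

lemma roots_of_unity_partition:
  assumes "n > 0"
  shows "{z. z ^ n = 1} = (\<Union>d\<in>{d. d dvd n}. {z. primitive_root_of_unity d z})"
proof (intro equalityI subsetI)
  fix z :: complex assume "z \<in> {z. z ^ n = 1}"
  then have z: "z ^ n = 1" by simp
  define d where "d = (LEAST k. 0 < k \<and> z ^ k = 1)"
  have d: "0 < d \<and> z ^ d = 1"
    unfolding d_def by (rule LeastI[of _ n]) (use assms z in auto)
  have least: "z ^ k \<noteq> 1" if "0 < k" "k < d" for k
    using not_less_Least[of k "\<lambda>k. 0 < k \<and> z ^ k = 1"] that by (auto simp: d_def)
  have "z ^ (n mod d) = 1"
  proof -
    have "z ^ n = (z ^ d) ^ (n div d) * z ^ (n mod d)"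
      by (simp flip: power_mult power_add)
    then show ?thesis using z d by simp
  qed
  then have "d dvd n"
    using least[of "n mod d"] d by (auto simp: dvd_eq_mod_eq_0)
  then show "z \<in> (\<Union>d\<in>{d. d dvd n}. {z. primitive_root_of_unity d z})"
    using d least by (auto simp: primitive_root_of_unity_def)
next
  fix z :: complex assume "z \<in> (\<Union>d\<in>{d. d dvd n}. {z. primitive_root_of_unity d z})"
  then show "z \<in> {z. z ^ n = 1}"
    by (auto simp: primitive_root_of_unity_def power_mult elim!: dvdE)
qed

lemma prod_roots_of_unity:
  assumes "n > 0"
  shows "(\<Prod>z | z ^ n = 1. [:-z, 1:]) = (monom 1 n - 1 :: complex poly)"
proof (rule ccontr)
  let ?A = "{z :: complex. z ^ n = 1}"
  define P where "P = (\<Prod>z\<in>?A. [:-z, 1:])"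
  define D where "D = P - (monom 1 n - 1)"
  assume "\<not> ?thesis"
  then have D: "D \<noteq> 0" by (simp add: D_def P_def)
  have fin: "finite ?A" using assms by (intro finite_roots_unity) auto
  have card: "card ?A = n" using assms by (rule card_roots_unity_eq)
  have deg: "degree P = n"
    unfolding P_def using card by (subst degree_prod_eq_sum_degree) auto
  have lead: "lead_coeff P = 1"
    unfolding P_def by (simp add: lead_coeff_prod)
  have "coeff D k = 0" if "k \<ge> n" for k
  proof (cases "k = n")
    case True
    then show ?thesis using lead deg assms by (simp add: D_def coeff_1)
  next
    case False
    then show ?thesis using that deg assms by (simp add: D_def coeff_eq_0 coeff_1)
  qed
  then have degD: "degree D < n"
    using D by (metis leading_coeff_0_iff linorder_not_le)
  have "?A \<subseteq> {z. poly D z = 0}"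
    using fin by (auto simp: D_def P_def poly_prod poly_monom intro!: prod_zero)
  then have "n \<le> card {z. poly D z = 0}"
    using card poly_roots_finite[OF D] by (metis card_mono)
  also have "\<dots> \<le> degree D" using D by (rule card_poly_roots_bound)
  finally show False using degD by simp
qed

lemma prod_complex_cyclotomic:
  assumes "n > 0"
  shows "(\<Prod>d | d dvd n. complex_cyclotomic d) = monom 1 n - 1"
proof -
  have "(\<Prod>d | d dvd n. complex_cyclotomic d) =
        (\<Prod>z \<in> (\<Union>d\<in>{d. d dvd n}. {z. primitive_root_of_unity d z}). [:-z, 1:])"
    unfolding complex_cyclotomic_def
    by (rule prod.UNION_disjoint [symmetric])
       (use assms finite_primitive_roots primitive_root_of_unity_unique in auto)
  then show ?thesis
    using assms by (simp add: prod_roots_of_unity flip: roots_of_unity_partition)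
qed

lemma lead_coeff_complex_cyclotomic: "lead_coeff (complex_cyclotomic n) = 1"
  by (simp add: complex_cyclotomic_def lead_coeff_prod)

lemma map_poly_of_int_mult:
  "map_poly (of_int :: int \<Rightarrow> complex) (P * Q) = map_poly of_int P * map_poly of_int Q"
  by (rule poly_eqI) (simp add: coeff_map_poly coeff_mult)

lemma map_poly_of_int_prod:
  "map_poly (of_int :: int \<Rightarrow> complex) (prod f A) = (\<Prod>x\<in>A. map_poly of_int (f x))"
  by (induction A rule: infinite_finite_induct) (auto simp: map_poly_of_int_mult)

lemma map_poly_of_int_inj:
  assumes "map_poly (of_int :: int \<Rightarrow> complex) P = map_poly of_int Q"
  shows "P = Q"
proof (rule poly_eqI)
  fix k
  have "coeff (map_poly (of_int :: int \<Rightarrow> complex) P) k = coeff (map_poly of_int Q) k"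
    using assms by simp
  then show "coeff P k = coeff Q k" by (simp add: coeff_map_poly)
qed

lemma complex_cyclotomic_int: "\<exists>P. map_poly of_int P = complex_cyclotomic n"
proof (induction n rule: less_induct)
  case (less n)
  show ?case
  proof (cases "n = 0")
    case True
    then have "complex_cyclotomic n = 1"
      by (simp add: complex_cyclotomic_def primitive_root_of_unity_def)
    then show ?thesis by (intro exI[of _ 1]) simp
  next
    case False
    then have n: "n > 0" by simp
    define A where "A = {d. d dvd n} - {n}"
    have lt: "d < n" if "d \<in> A" for d
      using that n by (auto simp: A_def dest: dvd_imp_le)
    from less obtain f where
      f: "\<And>d. d < n \<Longrightarrow> map_poly of_int (f d) = complex_cyclotomic d" by metis
    define R where "R = prod f A"
    define S :: "int poly" where "S = monom 1 n - 1"
    define Rc :: "complex poly" where "Rc = map_poly of_int R"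
    have Rc: "Rc = (\<Prod>d\<in>A. complex_cyclotomic d)"
      using f lt by (simp add: R_def Rc_def map_poly_of_int_prod)
    have degRc: "degree Rc = degree R"
      unfolding Rc_def by (rule degree_map_poly) auto
    have "lead_coeff Rc = 1"
      unfolding Rc by (simp add: lead_coeff_prod lead_coeff_complex_cyclotomic)
    then have lR: "lead_coeff R = 1"
      unfolding degRc by (simp add: Rc_def coeff_map_poly)
    then have R0: "R \<noteq> 0" by auto
    then have Rc0: "Rc \<noteq> 0" by (simp add: Rc_def map_poly_eq_0_iff)
    obtain q r where qr: "pseudo_divmod S R = (q, r)" by fastforce
    from pseudo_divmod[OF R0 qr] lR have S: "S = R * q + r" and r: "r = 0 \<or> degree r < degree R"
      by auto
    have "Rc * complex_cyclotomic n = (\<Prod>d | d dvd n. complex_cyclotomic d)"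
      unfolding Rc A_def using n
      by (subst (2) prod.remove[of _ n]) (auto simp: mult.commute)
    also have "\<dots> = map_poly of_int S"
      unfolding prod_complex_cyclotomic[OF n] S_def
      by (rule poly_eqI) (simp add: coeff_map_poly coeff_1)
    also have "\<dots> = Rc * map_poly of_int q + map_poly of_int r"
      unfolding S Rc_def map_poly_of_int_mult[symmetric]
      by (rule poly_eqI) (simp add: coeff_map_poly)
    finally have *: "Rc * (complex_cyclotomic n - map_poly of_int q) = map_poly of_int r"
      by (simp add: algebra_simps)
    have "r = 0"
    proof (rule ccontr)
      assume r0: "r \<noteq> 0"
      then have "map_poly of_int r \<noteq> (0 :: complex poly)" by (simp add: map_poly_eq_0_iff)
      with * have "complex_cyclotomic n - map_poly of_int q \<noteq> 0" by auto
      then have "degree Rc \<le> degree (map_poly of_int r :: complex poly)"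
        unfolding *[symmetric] using Rc0 by (subst degree_mult_eq) auto
      also have "\<dots> = degree r" by (rule degree_map_poly) auto
      finally show False using r r0 degRc by simp
    qed
    with * Rc0 show ?thesis by auto
  qed
qed

lemma cyclotomic_eqI:
  assumes "map_poly of_int P = complex_cyclotomic n"
  shows "cyclotomic n = P"
  unfolding cyclotomic_def
  by (rule the_equality) (use assms in \<open>auto intro: map_poly_of_int_inj\<close>)

lemma of_int_cyclotomic: "map_poly of_int (cyclotomic n) = complex_cyclotomic n"
  using complex_cyclotomic_int[of n] cyclotomic_eqI by blast

end

theory Submission
  imports Defs
begin

text \<open>
  Write \<open>S\<close> for the double sum. For fixed \<open>i\<close> the inner sum is geometric with ratio \<open>X\<^sup>q\<close>, running
  over the exponents below \<open>p i\<close> that are congruent to \<open>p i\<close> modulo \<open>q\<close>, so \<open>(X\<^sup>q - 1) S\<close> is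
  the sum of \<open>X\<close> to the powers \<open>p i\<close> minus the sum of \<open>X\<close> to the powers \<open>p i mod q\<close>. As \<open>p\<close> is
  invertible modulo \<open>q\<close>, the latter exponents are \<open>0, \<dots>, q - 1\<close> in some order. Summing the two
  geometric series gives \<open>(X\<^sup>p - 1) (X\<^sup>q - 1) (1 + (X - 1) S) = (X - 1) (X\<^bsup>p q\<^esup> - 1)\<close>, which is also
  satisfied by the cyclotomic polynomial in place of \<open>1 + (X - 1) S\<close>.
\<close>

text \<open>Multiplying \<open>cyclotomic d\<close> over the divisors \<open>d\<close> of
  \<open>n\<close> gives \<open>monom 1 n - 1\<close>. With \<open>n\<close> equal to
  \<open>1\<close>, \<open>p\<close>, \<open>q\<close> and \<open>p * q\<close>, both sides factor
  as \<open>cyclotomic 1\<close> squared times the other three cyclotomic polynomials.\<close>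

lemma cyclotomic_prime_mult:
  fixes p q :: nat
  assumes "prime p" "prime q" "p \<noteq> q"
  shows "(monom 1 p - 1) * (monom 1 q - 1) * cyclotomic (p * q) =
    (monom 1 1 - 1) * (monom 1 (p * q) - 1)"
proof -
  have prod_cyclotomic: "(\<Prod>d | d dvd n. cyclotomic d) = monom 1 n - 1" if n: "n > 0" for n
  proof (rule map_poly_of_int_inj)
    have "map_poly of_int (monom 1 n - 1 :: int poly) = (monom 1 n - 1 :: complex poly)"
      by (rule poly_eqI) (simp add: coeff_map_poly coeff_1)
    then show "map_poly of_int (\<Prod>d | d dvd n. cyclotomic d) =
        (map_poly of_int (monom 1 n - 1) :: complex poly)"
      by (simp add: map_poly_of_int_prod of_int_cyclotomic prod_complex_cyclotomic n)
  qed
  have divisors_mult: "{d. d dvd p * q} = {1, p, q, p * q}"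
  proof (intro equalityI subsetI)
    fix d assume "d \<in> {d. d dvd p * q}"
    then obtain a b where "d = a * b" "a dvd p" "b dvd q"
      by (auto elim: dvd_productE)
    moreover have "a \<in> {1, p}" "b \<in> {1, q}"
      using calculation assms by (auto simp: prime_nat_iff)
    ultimately show "d \<in> {1, p, q, p * q}"
      by auto
  qed auto
  have pq: "p > 1" "q > 1"
    using assms by (auto intro: prime_gt_1_nat simp del: One_nat_def)
  have prime_dvds: "{d. d dvd r} = {1, r}" if "prime r" for r :: nat
    using that by (auto simp: prime_nat_iff)
  have c1: "cyclotomic 1 = monom 1 1 - 1"
    using prod_cyclotomic[of 1] by simp
  have cp: "cyclotomic 1 * cyclotomic p = monom 1 p - 1"
    using prod_cyclotomic[of p] prime_dvds[OF assms(1)] pq by simp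
  have cq: "cyclotomic 1 * cyclotomic q = monom 1 q - 1"
    using prod_cyclotomic[of q] prime_dvds[OF assms(2)] pq by simp
  have "cyclotomic 1 * (cyclotomic p * (cyclotomic q * cyclotomic (p * q))) = monom 1 (p * q) - 1"
    using prod_cyclotomic[of "p * q"] pq assms(3)
    unfolding divisors_mult by simp
  then show ?thesis
    unfolding cp[symmetric] cq[symmetric] c1[symmetric] by (simp only: mult_ac)
qed

lemma geometric_sum_residue_class:
  fixes x :: "'a :: comm_ring_1"
  shows "(x ^ q - 1) * (\<Sum>j = 1..n div q. x ^ (n - q * j)) = x ^ n - x ^ (n mod q)"
proof -
  \<comment> \<open>Reversing the order by \<open>k = n div q - j\<close> makes the exponents
    increase from \<open>n mod q\<close> in steps of \<open>q\<close>.\<close>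
  have "(\<Sum>j = 1..n div q. x ^ (n - q * j)) = (\<Sum>k<n div q. x ^ (n mod q) * (x ^ q) ^ k)"
  proof (rule sum.reindex_bij_witness[of _ "\<lambda>k. n div q - k" "\<lambda>j. n div q - j"])
    fix j assume "j \<in> {1..n div q}"
    then have "n - q * j = n mod q + q * (n div q - j)"
      by (simp add: diff_mult_distrib2 minus_mult_div_eq_mod [symmetric])
    then show "x ^ (n mod q) * (x ^ q) ^ (n div q - j) = x ^ (n - q * j)"
      by (simp add: power_add power_mult)
  qed auto
  then have "(x ^ q - 1) * (\<Sum>j = 1..n div q. x ^ (n - q * j)) =
      x ^ (n mod q) * ((x ^ q) ^ (n div q) - 1)"
    by (simp add: power_diff_1_eq mult.left_commute flip: sum_distrib_left)
  also have "\<dots> = x ^ n - x ^ (n mod q)"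
    by (simp add: right_diff_distrib flip: power_mult power_add)
  finally show ?thesis .
qed

text \<open>Injectivity suffices on a finite set mapped to itself; a collision would make
  \<open>q\<close> divide \<open>j - i\<close>, which lies strictly between \<open>0\<close> and
  \<open>q\<close>.\<close>

lemma bij_betw_mult_mod:
  fixes p q :: nat
  assumes "coprime p q"
  shows "bij_betw (\<lambda>i. p * i mod q) {..<q} {..<q}"
proof -
  have "inj_on (\<lambda>i. p * i mod q) {..<q}"
  proof (rule linorder_inj_onI)
    fix i j assume "i < j" "i \<in> {..<q}" "j \<in> {..<q}"
    show "p * i mod q \<noteq> p * j mod q"
    proof
      assume "p * i mod q = p * j mod q"
      then have "q dvd p * (j - i)"
        using \<open>i < j\<close> by (simp add: mod_eq_dvd_iff_nat[of "p * i" "p * j", symmetric] diff_mult_distrib2)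
      then have "q dvd j - i"
        using assms by (simp add: coprime_commute coprime_dvd_mult_right_iff)
      then show False
        using \<open>i < j\<close> \<open>j \<in> {..<q}\<close> by (auto dest: dvd_imp_le)
    qed
  qed auto
  then show ?thesis
    unfolding bij_betw_def by (intro conjI endo_inj_surj) auto
qed

text \<open>The factors stay multiplied out, so that no cancellation is required and any commutative
  ring will do.\<close>

lemma coprime_double_sum:
  fixes x :: "'a :: comm_ring_1"
  assumes "coprime p q"
  defines "S \<equiv> \<Sum>i<q. \<Sum>j = 1..p * i div q. x ^ (p * i - q * j)"
  shows "(x ^ p - 1) * (x ^ q - 1) * (1 + (x - 1) * S) = (x - 1) * (x ^ (p * q) - 1)"
proof -
  have "(x ^ q - 1) * S = (\<Sum>i<q. x ^ (p * i)) - (\<Sum>i<q. x ^ (p * i mod q))"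
    unfolding S_def sum_distrib_left[of _ _ "{..<q}"] geometric_sum_residue_class sum_subtractf ..
  also have "(\<Sum>i<q. x ^ (p * i mod q)) = (\<Sum>r<q. x ^ r)"
    by (rule sum.reindex_bij_betw[OF bij_betw_mult_mod[OF assms(1)]])
  finally have S: "(x ^ q - 1) * S = (\<Sum>i<q. x ^ (p * i)) - (\<Sum>r<q. x ^ r)" .
  have p: "(x ^ p - 1) * (\<Sum>i<q. x ^ (p * i)) = x ^ (p * q) - 1"
    by (simp add: power_mult power_diff_1_eq)
  have q: "(x - 1) * (\<Sum>r<q. x ^ r) = x ^ q - 1"
    by (simp add: power_diff_1_eq)
  have "(x ^ p - 1) * (x ^ q - 1) * (1 + (x - 1) * S) =
      (x ^ p - 1) * (x ^ q - 1) + (x - 1) * (x ^ p - 1) * ((x ^ q - 1) * S)"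
    by (simp add: algebra_simps)
  also have "\<dots> = (x ^ p - 1) * (x ^ q - 1) + (x - 1) * ((x ^ p - 1) * (\<Sum>i<q. x ^ (p * i)))
      - (x ^ p - 1) * ((x - 1) * (\<Sum>r<q. x ^ r))"
    unfolding S by (simp add: algebra_simps)
  \<comment> \<open>By \<open>q\<close> the last term becomes the first one with opposite sign, so
    the two cancel.\<close>
  also have "\<dots> = (x - 1) * (x ^ (p * q) - 1)"
    unfolding p q by simp
  finally show ?thesis .
qed

theorem theorem2:
  fixes p q :: nat
  assumes "prime p" and "prime q" and "p \<noteq> q" and "p > q"
  shows "cyclotomic (p * q) =
           1 + ([:0, 1:] - 1) *
             (\<Sum>i = 0..q - 1. \<Sum>j = 1..nat \<lfloor>real (p * i) / real q\<rfloor>. [:0, 1:] ^ (p * i - q * j))"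
    (is "_ = ?R")
proof -
  let ?X = "[:0, 1:] :: int poly"
  have pos: "p > 0" "q > 0"
    using assms by (auto simp: prime_gt_0_nat)
  have monom: "monom 1 n = ?X ^ n" for n
    by (simp add: monom_altdef)
  \<comment> \<open>This allows the two factors to be cancelled at the end. For \<open>n > 0\<close>
    the constant \<open>1\<close> does not affect the coefficient at \<open>n\<close>.\<close>
  have nz: "?X ^ n - 1 \<noteq> 0" if "n > 0" for n
  proof
    assume "?X ^ n - 1 = 0"
    then have "coeff (monom 1 n - 1 :: int poly) n = 0"
      by (simp add: monom)
    then show False
      using that by (simp add: coeff_1)
  qed
  have "nat \<lfloor>real (p * i) / real q\<rfloor> = p * i div q" for i
    by (metis floor_divide_of_nat_eq nat_int)
  \<comment> \<open>Subtraction is truncated: for \<open>q = 0\<close> the left side would be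
    \<open>{0}\<close>.\<close>
  moreover have "{0..q - 1} = {..<q}"
    using pos by auto
  ultimately have R: "?R = 1 + (?X - 1) * (\<Sum>i<q. \<Sum>j = 1..p * i div q. ?X ^ (p * i - q * j))"
    by (simp only:)
  have "coprime p q"
    using assms by (simp add: primes_coprime)
  from coprime_double_sum[OF this, of ?X]
  have "(?X ^ p - 1) * (?X ^ q - 1) * ?R = (?X - 1) * (?X ^ (p * q) - 1)"
    unfolding R .
  also have "\<dots> = (?X ^ p - 1) * (?X ^ q - 1) * cyclotomic (p * q)"
    using cyclotomic_prime_mult[OF assms(1-3)] by (simp only: monom power_one_right)
  finally show ?thesis
    using nz[OF pos(1)] nz[OF pos(2)] by (simp only: mult_cancel_left mult_eq_0_iff simp_thms)
qed

end
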